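(* Let $1.77\le\alpha\le\alpha_c(1)\approx 1.8159$ and $M=\lfloor n\alpha\rfloor$. Then there exists a constant $c_f>0$ such that, for all sufficiently large $n$, for any $p_f<\frac12-\exp(-c_fn)$ there is no algorithm $\mathcal{A}:\mathbb{R}^{M\times n}\to\mathcal{B}_n$ which is $p_f$-online.
   Context: $\mathcal{B}_n=\{-1,1\}^n$, $\alpha_c(1)=-1/\log_2\mathbb{P}[|Z|\le1]$ with $Z\sim\mathcal{N}(0,1)$. An algorithm $\mathcal{A}:\mathbb{R}^{M\times n}\to\mathcal{B}_n$, writing $\mathcal{A}(\mathcal{M})=(\sigma_1,\dots,\sigma_n)$ and $\mathcal{C}_1,\dots,\mathcal{C}_n\in\mathbb{R}^M$ for the columns of $\mathcal{M}$, is $p_f$-online if (Success) for $\mathcal{M}$ with i.i.d. $\mathcal{N}(0,1)$ entries, $\mathbb{P}[\|\mathcal{M}\mathcal{A}(\mathcal{M})\|_\infty\le\sqrt n]\ge1-p_f$; and (Online) there are deterministic functions $f_t$ with $\sigma_t=f_t(\mathcal{C}_1,\dots,\mathcal{C}_t)\in\{-1,1\}$ for $1\le t\le n$. *)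

theory Defs
  imports "HOL-Probability.Probability"
begin

definition std_normal :: "real measure" where
  "std_normal = density lborel (\<lambda>x. ennreal (std_normal_density x))"

definition alpha_c :: "real \<Rightarrow> real" where
  "alpha_c \<kappa> = - 1 / log 2 (measure std_normal {z. \<bar>z\<bar> \<le> \<kappa>})"

text \<open>
  The dimensions vary inside the statement, so vectors and matrices are extensional functions
  on the index sets \<open>{1..n}\<close> and \<open>{1..m} \<times> {1..n}\<close> (row, column), with junk value outside.
\<close>

definition cube :: "nat \<Rightarrow> (nat \<Rightarrow> real) set" where
  "cube n = {1..n} \<rightarrow>\<^sub>E {-1, 1}"

definition vectors :: "nat \<Rightarrow> (nat \<Rightarrow> real) set" where
  "vectors m = {1..m} \<rightarrow>\<^sub>E UNIV"

definition matrices :: "nat \<Rightarrow> nat \<Rightarrow> (nat \<times> nat \<Rightarrow> real) set" where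
  "matrices m n = {1..m} \<times> {1..n} \<rightarrow>\<^sub>E UNIV"

definition gaussian_matrix :: "nat \<Rightarrow> nat \<Rightarrow> (nat \<times> nat \<Rightarrow> real) measure" where
  "gaussian_matrix m n = (\<Pi>\<^sub>M ij \<in> {1..m} \<times> {1..n}. std_normal)"

definition column :: "nat \<Rightarrow> (nat \<times> nat \<Rightarrow> real) \<Rightarrow> nat \<Rightarrow> (nat \<Rightarrow> real)" where
  "column m X t = (\<lambda>i\<in>{1..m}. X (i, t))"

definition mat_vec :: "nat \<Rightarrow> nat \<Rightarrow> (nat \<times> nat \<Rightarrow> real) \<Rightarrow> (nat \<Rightarrow> real) \<Rightarrow> (nat \<Rightarrow> real)" where
  "mat_vec m n X v = (\<lambda>i\<in>{1..m}. \<Sum>j\<in>{1..n}. X (i, j) * v j)"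

text \<open>The inserted 0 only matters for \<open>m = 0\<close>, where it gives the empty vector norm 0.\<close>

definition sup_norm :: "nat \<Rightarrow> (nat \<Rightarrow> real) \<Rightarrow> real" where
  "sup_norm m v = Max (insert 0 ((\<lambda>i. \<bar>v i\<bar>) ` {1..m}))"

definition success_event ::
  "nat \<Rightarrow> nat \<Rightarrow> ((nat \<times> nat \<Rightarrow> real) \<Rightarrow> (nat \<Rightarrow> real)) \<Rightarrow> (nat \<times> nat \<Rightarrow> real) set" where
  "success_event m n A = {X \<in> matrices m n. sup_norm m (mat_vec m n X (A X)) \<le> sqrt (real n)}"

text \<open>
  The only measurability required of an algorithm is that its success event has a probability.
  In the last condition, \<open>f t\<close> receives the sequence of the first \<open>t\<close> columns, as an extensional
  function on \<open>{1..t}\<close>.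
\<close>

definition online_algorithm ::
  "real \<Rightarrow> nat \<Rightarrow> nat \<Rightarrow> ((nat \<times> nat \<Rightarrow> real) \<Rightarrow> (nat \<Rightarrow> real)) \<Rightarrow> bool" where
  "online_algorithm p m n A \<longleftrightarrow>
     A \<in> matrices m n \<rightarrow> cube n \<and>
     success_event m n A \<in> sets (gaussian_matrix m n) \<and>
     measure (gaussian_matrix m n) (success_event m n A) \<ge> 1 - p \<and>
     (\<exists>f :: nat \<Rightarrow> (nat \<Rightarrow> nat \<Rightarrow> real) \<Rightarrow> real.
        \<forall>t\<in>{1..n}. f t \<in> ({1..t} \<rightarrow>\<^sub>E vectors m) \<rightarrow> {-1, 1} \<and>
          (\<forall>X\<in>matrices m n. A X t = f t (\<lambda>s\<in>{1..t}. column m X s)))"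

end

theory Submission
  imports Defs
begin

text \<open>
  Run the algorithm on a Gaussian matrix and on a copy whose last \<open>d = n div 25\<close> columns are drawn
  afresh. If the failure probability is below \<open>1/2 - exp (- c n)\<close>, both runs succeed with
  probability above \<open>2 exp (- c n)\<close>, and by the online property the two outputs agree in the first
  \<open>n - d\<close> coordinates. There are \<open>2 ^ (n + d)\<close> such pairs of sign vectors, and for a fixed pair the
  rows are independent, so it suffices that each row satisfies both constraints with probability
  at most \<open>q\<close> where \<open>2 powr 1.04 * q powr 1.77 < 1\<close>; this holds for \<open>q = 0.664\<close>.

  For one row, write the normalised inner products as \<open>a + b\<close> and \<open>a + c\<close> with independent centred
  normals \<open>a\<close>, \<open>b\<close>, \<open>c\<close> of variances \<open>1 - s\<^sup>2\<close>, \<open>s\<^sup>2\<close>, \<open>s\<^sup>2\<close>, where \<open>s\<close> is about \<open>0.2\<close>. Here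
  \<open>\<bar>a + b\<bar> \<le> 1\<close> has probability at most \<open>0.685\<close>, and four disjoint boxes in \<open>(a, b, c)\<close> with \<open>a\<close> within
  \<open>s\<close> of 1, together with their reflections, show that \<open>\<bar>a + b\<bar> \<le> 1 < \<bar>a + c\<bar>\<close> has probability at
  least \<open>0.022\<close>.
\<close>

section \<open>The standard normal distribution\<close>

lemma space_std_normal [simp]: "space std_normal = UNIV"
  and sets_std_normal [simp, measurable_cong]: "sets std_normal = sets borel"
  by (simp_all add: std_normal_def)

lemma prob_space_std_normal: "prob_space std_normal"
  unfolding std_normal_def by (rule prob_space_normal_density) simp

interpretation std_normal: prob_space std_normal
  by (rule prob_space_std_normal)

lemma distributed_std_normal: "distributed std_normal lborel (\<lambda>x. x) std_normal_density"
  unfolding distributed_def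
  by (auto simp: std_normal_def intro!: measure_eqI simp: emeasure_distr)

lemma (in prob_space) distributed_std_normal_prob:
  assumes "distributed M lborel X std_normal_density" "A \<in> sets borel"
  shows "prob {\<omega> \<in> space M. X \<omega> \<in> A} = measure std_normal A"
proof -
  have "distr M lborel X = std_normal" and [measurable]: "X \<in> borel_measurable M"
    using assms(1) by (auto simp: distributed_def std_normal_def)
  then have "measure std_normal A = measure (distr M lborel X) A" by simp
  also have "\<dots> = prob (X -` A \<inter> space M)"
    using assms by (subst measure_distr) auto
  also have "X -` A \<inter> space M = {\<omega> \<in> space M. X \<omega> \<in> A}" by auto
  finally show ?thesis by simp
qed

lemma measure_std_normal_uminus:
  assumes "A \<in> sets borel"
  shows "measure std_normal {x. - x \<in> A} = measure std_normal A"
proof -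
  have "distributed std_normal lborel (\<lambda>x. 0 + (-1) * x) (normal_density (0 + (-1) * 0) (\<bar>-1\<bar> * 1))"
    by (rule std_normal.normal_density_affine[OF distributed_std_normal]) auto
  then show ?thesis
    using std_normal.distributed_std_normal_prob[of "\<lambda>x. - x" A] assms by simp
qed

lemma emeasure_std_normal:
  "A \<in> sets borel \<Longrightarrow> emeasure std_normal A = (\<integral>\<^sup>+x. ennreal (std_normal_density x) * indicator A x \<partial>lborel)"
  unfolding std_normal_def by (subst emeasure_density) auto

lemma measure_std_normal_singleton [simp]: "measure std_normal {x} = 0"
proof -
  have "emeasure std_normal {x} = (\<integral>\<^sup>+y. ennreal (std_normal_density y) * indicator {x} y \<partial>lborel)"
    by (rule emeasure_std_normal) simp
  also have "\<dots> = 0"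
    by (subst nn_integral_indicator_singleton) auto
  finally show ?thesis by (simp add: measure_def)
qed

lemma measure_std_normal_nonneg_half: "measure std_normal {0<..} = 1/2"
proof -
  have "{x. - x \<in> {0::real<..}} = {..<0}" by auto
  then have "measure std_normal {..<0} = measure std_normal {0<..}"
    using measure_std_normal_uminus[of "{0<..}"] by simp
  moreover have "measure std_normal ({..<0} \<union> ({0} \<union> {0<..}))
      = measure std_normal {..<0} + measure std_normal ({0} \<union> {0<..})"
    by (rule std_normal.finite_measure_Union) auto
  moreover have "measure std_normal ({0} \<union> {0<..}) = measure std_normal {0} + measure std_normal {0<..}"
    by (rule std_normal.finite_measure_Union) auto
  moreover have "{..<0} \<union> ({0} \<union> {0<..}) = (UNIV :: real set)" by auto
  ultimately show ?thesis using std_normal.prob_space by simp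
qed

section \<open>Explicit numerical bounds for Gaussian probabilities\<close>

lemma inverse_sqrt_2pi_bounds: "0.398 \<le> 1 / sqrt (2 * pi)" "1 / sqrt (2 * pi) \<le> 0.399"
proof -
  have "sqrt (2 * pi) \<le> 1 / 0.398"
    using pi_approx by (intro real_le_lsqrt) (auto simp: power2_eq_square)
  moreover have "1 / 0.399 \<le> sqrt (2 * pi)"
    using pi_approx by (intro real_le_rsqrt) (auto simp: power2_eq_square)
  moreover have "sqrt (2 * pi) > 0" by simp
  ultimately show "0.398 \<le> 1 / sqrt (2 * pi)" "1 / sqrt (2 * pi) \<le> 0.399"
    by (auto simp: field_simps)
qed

text \<open>\<open>exp y\<close> dominates \<open>1 + y + y\<^sup>2 / 2\<close>, whose product with
  the right-hand side is \<open>1 + y ^ 4 / 4\<close>, hence at least 1.\<close>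

lemma exp_minus_le_quadratic:
  assumes "0 \<le> (y::real)"
  shows "exp (- y) \<le> 1 - y + y\<^sup>2 / 2"
proof -
  have "0 < 1 + y + y\<^sup>2 / 2" using assms by (simp add: add_pos_nonneg)
  then have "exp (- y) \<le> 1 / (1 + y + y\<^sup>2 / 2)"
    using exp_lower_Taylor_quadratic[OF assms] by (simp add: exp_minus field_simps)
  also have "\<dots> \<le> 1 - y + y\<^sup>2 / 2"
  proof -
    have "(1 - y + y\<^sup>2 / 2) * (1 + y + y\<^sup>2 / 2) = 1 + y ^ 4 / 4"
      by (simp add: algebra_simps power2_eq_square power4_eq_xxxx)
    moreover have "y ^ 4 / 4 \<ge> 0" by simp
    ultimately show ?thesis
      using \<open>0 < 1 + y + y\<^sup>2 / 2\<close> by (simp add: divide_le_eq)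
  qed
  finally show ?thesis .
qed

text \<open>The density decreases on the nonnegative axis, so its minimum over the interval is its
  value at \<open>u\<close>.\<close>

lemma measure_std_normal_ge_rectangle:
  assumes "0 \<le> l" "l \<le> u"
  shows "(u - l) * std_normal_density u \<le> measure std_normal {l<..u}"
proof -
  have "ennreal ((u - l) * std_normal_density u)
      = (\<integral>\<^sup>+x. ennreal (std_normal_density u) * indicator {l<..u} x \<partial>lborel)"
    using assms by (subst nn_integral_cmult_indicator) (auto simp: ennreal_mult' mult.commute)
  also have "\<dots> \<le> (\<integral>\<^sup>+x. ennreal (std_normal_density x) * indicator {l<..u} x \<partial>lborel)"
    using assms
    by (intro nn_integral_mono)
      (auto simp: indicator_def std_normal_density_def intro!: divide_right_mono power_mono)
  also have "\<dots> = ennreal (measure std_normal {l<..u})"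
    by (subst emeasure_std_normal[symmetric]) (auto simp: std_normal.emeasure_eq_measure)
  finally show ?thesis by (simp add: ennreal_le_iff)
qed

text \<open>Integrates the quadratic bound for \<open>exp (- y)\<close> at
  \<open>y = x\<^sup>2 / 2\<close>, with 0.399 in place of the normalising constant.\<close>

lemma measure_std_normal_le_quintic:
  assumes "0 \<le> u"
  shows "measure std_normal {0..u} \<le> 0.399 * (u - u ^ 3 / 6 + u ^ 5 / 40)"
proof -
  let ?f = "\<lambda>x::real. 0.399 * (1 - x\<^sup>2 / 2 + (x\<^sup>2 / 2)\<^sup>2 / 2)"
  let ?F = "\<lambda>x::real. 0.399 * (x - x ^ 3 / 6 + x ^ 5 / 40)"
  have le: "std_normal_density x \<le> ?f x" for x
    unfolding std_normal_density_def
    using exp_minus_le_quadratic[of "x\<^sup>2 / 2"] inverse_sqrt_2pi_bounds(2)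
    by (intro mult_mono) auto
  have nonneg: "0 \<le> ?f x" for x
    using le[of x] normal_density_nonneg[of 0 1 x] by linarith
  have "ennreal (measure std_normal {0..u})
      = (\<integral>\<^sup>+x. ennreal (std_normal_density x) * indicator {0..u} x \<partial>lborel)"
    by (subst emeasure_std_normal[symmetric]) (auto simp: std_normal.emeasure_eq_measure)
  also have "\<dots> \<le> (\<integral>\<^sup>+x. ennreal (?f x) * indicator {0..u} x \<partial>lborel)"
    using le by (intro nn_integral_mono mult_right_mono ennreal_leI) auto
  also have "\<dots> = ennreal (?F u - ?F 0)"
  proof (rule nn_integral_FTC_Icc)
    show "DERIV ?F x :> ?f x" if "x \<in> {0..u}" for x
      by (auto intro!: derivative_eq_intros simp: power2_eq_square eval_nat_numeral field_simps)
  qed (use nonneg assms in auto)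
  finally have "ennreal (measure std_normal {0..u}) \<le> ennreal (?F u)" by simp
  \<comment> \<open>Returning from \<open>ennreal\<close> to the reals requires a nonnegative upper
    bound; completing the square provides it.\<close>
  moreover have "0 \<le> ?F u"
  proof -
    have "u * (1 - u\<^sup>2 / 6 + u ^ 4 / 40) \<ge> 0"
    proof (intro mult_nonneg_nonneg assms)
      have "1 - u\<^sup>2 / 6 + u ^ 4 / 40 = (1 - u\<^sup>2 / 12)\<^sup>2 + (1 / 40 - 1 / 144) * u ^ 4"
        by (simp add: power2_eq_square eval_nat_numeral field_simps)
      also have "\<dots> \<ge> 0" by simp
      finally show "1 - u\<^sup>2 / 6 + u ^ 4 / 40 \<ge> 0" .
    qed
    also have "u * (1 - u\<^sup>2 / 6 + u ^ 4 / 40) = u - u ^ 3 / 6 + u ^ 5 / 40"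
      by (simp add: power2_eq_square eval_nat_numeral field_simps)
    finally show ?thesis by simp
  qed
  ultimately show ?thesis by (simp add: ennreal_le_iff)
qed

lemma measure_std_normal_greaterThan:
  assumes "0 \<le> x"
  shows "measure std_normal {x<..} = 1/2 - measure std_normal {0..x}"
    and "measure std_normal {- x<..} = 1/2 + measure std_normal {0..x}"
proof -
  have *: "measure std_normal ({0} \<union> {0<..}) = measure std_normal {0} + measure std_normal {0<..}"
    by (rule std_normal.finite_measure_Union) auto
  have "{0..x} \<union> {x<..} = {0} \<union> {0<..}" using assms by auto
  moreover have "measure std_normal ({0..x} \<union> {x<..}) = measure std_normal {0..x} + measure std_normal {x<..}"
    by (rule std_normal.finite_measure_Union) auto
  ultimately show 1: "measure std_normal {x<..} = 1/2 - measure std_normal {0..x}"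
    using * measure_std_normal_nonneg_half by simp
  have "{y. - y \<in> {x<..}} = {..<-x}" by auto
  then have 2: "measure std_normal {..<-x} = measure std_normal {x<..}"
    using measure_std_normal_uminus[of "{x<..}"] by simp
  have "measure std_normal ({..<-x} \<union> ({-x} \<union> {-x<..}))
      = measure std_normal {..<-x} + measure std_normal ({-x} \<union> {-x<..})"
    by (rule std_normal.finite_measure_Union) auto
  moreover have "measure std_normal ({-x} \<union> {-x<..}) = measure std_normal {-x} + measure std_normal {-x<..}"
    by (rule std_normal.finite_measure_Union) auto
  moreover have "{..<-x} \<union> ({-x} \<union> {-x<..}) = UNIV" by auto
  ultimately show "measure std_normal {- x<..} = 1/2 + measure std_normal {0..x}"
    using std_normal.prob_space 1 2 by simp
qed

lemma measure_std_normal_atLeastAtMost_symmetric: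
  assumes "0 \<le> x"
  shows "measure std_normal {- x..x} = 2 * measure std_normal {0..x}"
proof -
  have 1: "measure std_normal ({- x} \<union> {-x<..}) = measure std_normal {- x} + measure std_normal {-x<..}"
    by (rule std_normal.finite_measure_Union) auto
  have 2: "measure std_normal ({- x..x} \<union> {x<..}) = measure std_normal {- x..x} + measure std_normal {x<..}"
    by (rule std_normal.finite_measure_Union) auto
  have "{- x} \<union> {-x<..} = {- x..x} \<union> {x<..}" using assms by auto
  then show ?thesis using 1 2 measure_std_normal_greaterThan[OF assms] by simp
qed

lemma measure_std_normal_tail: "measure std_normal {x. 9 \<le> \<bar>x\<bar>} \<le> 1 / 81"
proof -
  have e: "std_normal.expectation (\<lambda>x. x) = 0" and v: "std_normal.variance (\<lambda>x. x) = 1"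
    using std_normal.standard_normal_distributed_expectation[OF distributed_std_normal]
      std_normal.standard_normal_distributed_variance[OF distributed_std_normal] by simp_all
  have "integrable std_normal (\<lambda>x. x\<^sup>2)"
    unfolding std_normal_def using integrable_std_normal_moment[of 2]
    by (subst integrable_density) auto
  from std_normal.Chebyshev_inequality[OF _ this, of 9] show ?thesis
    using e v by simp
qed

text \<open>Reflection turns \<open>{-9..x}\<close> into \<open>{-x..9}\<close>, and what the
  half-line has beyond that lies in the tail past 9.\<close>

lemma measure_std_normal_truncated:
  assumes "-9 \<le> x"
  shows "measure std_normal {- x<..} - 1 / 81 \<le> measure std_normal {-9..x}"
proof -
  have "{y. - y \<in> {-9..x}} = {-x..9}" by auto
  then have "measure std_normal {-9..x} = measure std_normal {-x..9}"
    using measure_std_normal_uminus[of "{-9..x}"] by simp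
  moreover have "measure std_normal {- x<..} \<le> measure std_normal ({-x..9} \<union> {x. 9 \<le> \<bar>x\<bar>})"
    using assms by (intro std_normal.finite_measure_mono) auto
  moreover have "\<dots> \<le> measure std_normal {-x..9} + measure std_normal {x. 9 \<le> \<bar>x\<bar>}"
    by (intro measure_subadditive) auto
  ultimately show ?thesis using measure_std_normal_tail by linarith
qed

lemma std_normal_density_ge:
  assumes "u\<^sup>2 / 2 \<le> y"
  shows "0.398 * exp (- y) \<le> std_normal_density u"
  unfolding std_normal_density_def using assms inverse_sqrt_2pi_bounds(1)
  by (intro mult_mono) auto

lemma measure_std_normal_numeric:
  shows "measure std_normal {-1..1} \<le> 0.685"
    and "0.1575 \<le> measure std_normal {1<..}"
    and "0.308 \<le> measure std_normal {1/2<..}"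
    and "0.674 \<le> measure std_normal {-(1/2)<..}"
proof -
  have q1: "measure std_normal {0..1} \<le> 0.3425"
    using measure_std_normal_le_quintic[of 1] by simp
  have q2: "measure std_normal {0..1/2} \<le> 0.192"
    using measure_std_normal_le_quintic[of "1/2"] by (simp add: power_divide)
  show "measure std_normal {-1..1} \<le> 0.685"
    using measure_std_normal_atLeastAtMost_symmetric[of 1] q1 by simp
  show "0.1575 \<le> measure std_normal {1<..}" "0.308 \<le> measure std_normal {1/2<..}"
    using measure_std_normal_greaterThan(1)[of 1] measure_std_normal_greaterThan(1)[of "1/2"] q1 q2
    by simp_all
  \<comment> \<open>The last claim needs the mass near 0 from below, where the quintic estimate
    points the wrong way; one rectangle suffices.\<close>
  have "0.398 * exp (- (1/8)) \<le> std_normal_density (1/2)"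
    by (rule std_normal_density_ge) (simp add: power_divide)
  moreover have "7/8 \<le> exp (- (1/8) :: real)"
    using exp_ge_add_one_self[of "-(1/8)"] by simp
  moreover have "(1/2 - 0) * std_normal_density (1/2) \<le> measure std_normal {0<..1/2}"
    by (rule measure_std_normal_ge_rectangle) auto
  moreover have "measure std_normal {0<..1/2} \<le> measure std_normal {0..1/2}"
    by (intro std_normal.finite_measure_mono) auto
  ultimately have "0.174 \<le> measure std_normal {0..1/2}" by simp
  then show "0.674 \<le> measure std_normal {-(1/2)<..}"
    using measure_std_normal_greaterThan(2)[of "1/2"] by simp
qed

section \<open>Two correlated constraints in one row\<close>

text \<open>Holds for negative \<open>x\<close> too, because the Lagrange remainder has even order
  4; that is where it is applied.\<close>

lemma exp_ge_cubic: "1 + x + x\<^sup>2 / 2 + x ^ 3 / 6 \<le> exp (x::real)"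
proof -
  obtain t where "exp x = (\<Sum>m<4. x ^ m / fact m) + exp t / fact 4 * x ^ 4"
    using Maclaurin_exp_le[of x 4] by auto
  moreover have "exp t / fact 4 * x ^ 4 \<ge> 0" by simp
  ultimately show ?thesis by (simp add: eval_nat_numeral)
qed

lemma (in prob_space) normal_prob_scaled:
  assumes "distributed M lborel X (normal_density 0 \<sigma>)" "0 < \<sigma>" "A \<in> sets borel"
  shows "prob {\<omega> \<in> space M. X \<omega> / \<sigma> \<in> A} = measure std_normal A"
  using assms normal_standard_normal_convert[of \<sigma> X 0]
  by (intro distributed_std_normal_prob) auto

lemma (in prob_space) indep_vars_prob_3:
  fixes S :: "nat \<Rightarrow> 'a \<Rightarrow> real"
  assumes "indep_vars (\<lambda>_. borel) S {0, 1, 2}" and "A \<in> sets borel" "B \<in> sets borel" "C \<in> sets borel"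
  shows "prob {\<omega> \<in> space M. S 0 \<omega> \<in> A \<and> S 1 \<omega> \<in> B \<and> S 2 \<omega> \<in> C}
      = prob {\<omega> \<in> space M. S 0 \<omega> \<in> A} * prob {\<omega> \<in> space M. S 1 \<omega> \<in> B} * prob {\<omega> \<in> space M. S 2 \<omega> \<in> C}"
proof -
  define D where "D i = (if i = 0 then A else if i = (1::nat) then B else C)" for i
  have "prob (\<Inter>i\<in>{0, 1, 2}. S i -` D i \<inter> space M) = (\<Prod>i\<in>{0, 1, 2}. prob (S i -` D i \<inter> space M))"
    by (rule indep_varsD_finite[OF assms(1)]) (use assms in \<open>auto simp: D_def\<close>)
  moreover have "(\<Inter>i\<in>{0, 1, 2}. S i -` D i \<inter> space M)
      = {\<omega> \<in> space M. S 0 \<omega> \<in> A \<and> S 1 \<omega> \<in> B \<and> S 2 \<omega> \<in> C}"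
    by (auto simp: D_def)
  moreover have "S 0 -` A \<inter> space M = {\<omega> \<in> space M. S 0 \<omega> \<in> A}"
    "S 1 -` B \<inter> space M = {\<omega> \<in> space M. S 1 \<omega> \<in> B}"
    "S 2 -` C \<inter> space M = {\<omega> \<in> space M. S 2 \<omega> \<in> C}" by auto
  ultimately show ?thesis by (simp add: D_def mult.assoc)
qed

text \<open>
  One row of the two matrices, divided by \<open>sqrt n\<close> and applied to the two outputs: \<open>S 0\<close> is the
  contribution of the shared columns, \<open>S 1\<close> and \<open>S 2\<close> those of the two versions of the last \<open>s\<^sup>2 n\<close> columns.
\<close>

locale correlated_row = prob_space +
  fixes S :: "nat \<Rightarrow> 'a \<Rightarrow> real" and s :: real
  assumes indep: "indep_vars (\<lambda>_. borel) S {0, 1, 2}"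
    and S0: "distributed M lborel (S 0) (normal_density 0 (sqrt (1 - s\<^sup>2)))"
    and S1: "distributed M lborel (S 1) (normal_density 0 s)"
    and S2: "distributed M lborel (S 2) (normal_density 0 s)"
    and s: "0.199 \<le> s" "s \<le> 0.2"
begin

lemma s_sq: "s\<^sup>2 \<le> 0.04"
  using power_mono[of s "0.2" 2] s by (simp add: power2_eq_square)

lemma S_measurable [measurable]:
  "S 0 \<in> borel_measurable M" "S 1 \<in> borel_measurable M" "S (Suc 0) \<in> borel_measurable M"
  "S 2 \<in> borel_measurable M"
  using S0 S1 S2 by (auto simp: distributed_def)

text \<open>The variance of \<open>S 0\<close> is at least 0.96, so the Gaussian exponent at
  \<open>u\<close> is at most \<open>u\<^sup>2 / (2 * 0.96)\<close>. Rescaling to unit variance can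
  only widen the strip.\<close>

lemma prob_S0_strip:
  assumes "0 \<le> l" "l \<le> u" "u\<^sup>2 / 1.92 \<le> y"
  shows "(u - l) * (0.398 * exp (- y)) \<le> prob {\<omega> \<in> space M. S 0 \<omega> \<in> {l<..u}}"
proof -
  define t where "t = sqrt (1 - s\<^sup>2)"
  have t: "0 < t" "t \<le> 1" "t\<^sup>2 = 1 - s\<^sup>2" using s_sq by (auto simp: t_def)
  have "(u / t)\<^sup>2 / 2 \<le> u\<^sup>2 / 1.92"
  proof -
    have "u\<^sup>2 / (t\<^sup>2 * 2) \<le> u\<^sup>2 / 1.92"
      using s_sq t by (intro divide_left_mono) auto
    then show ?thesis by (simp add: power_divide)
  qed
  then have "(u / t)\<^sup>2 / 2 \<le> y" using assms by linarith
  then have d: "0.398 * exp (- y) \<le> std_normal_density (u / t)" by (rule std_normal_density_ge)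
  have "(u - l) * (0.398 * exp (- y)) \<le> (u / t - l / t) * std_normal_density (u / t)"
  proof (rule mult_mono[OF _ d])
    have "(u - l) * t \<le> (u - l) * 1" using t assms by (intro mult_left_mono) auto
    then show "u - l \<le> u / t - l / t" using t by (simp add: diff_divide_distrib[symmetric] field_simps)
    then show "0 \<le> u / t - l / t" using assms by linarith
  qed simp
  also have "\<dots> \<le> measure std_normal {l / t<..u / t}"
    using assms t by (intro measure_std_normal_ge_rectangle) (auto simp: divide_right_mono)
  also have "\<dots> = prob {\<omega> \<in> space M. S 0 \<omega> / t \<in> {l / t<..u / t}}"
    using S0 t(1) by (subst normal_prob_scaled) (auto simp: t_def)
  also have "{\<omega> \<in> space M. S 0 \<omega> / t \<in> {l / t<..u / t}} = {\<omega> \<in> space M. S 0 \<omega> \<in> {l<..u}}"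
    using t by (auto simp: divide_strict_right_mono divide_right_mono divide_less_cancel divide_le_cancel)
  finally show ?thesis .
qed

text \<open>
  The lower cut-off \<open>-9 * s\<close> keeps \<open>S 0 + S 1\<close> above \<open>-1\<close> for \<open>S 0\<close> near 1; it costs at most
  the tail bound \<open>1 / 81\<close>.
\<close>

definition box :: "real \<Rightarrow> real \<Rightarrow> real \<Rightarrow> real \<Rightarrow> 'a set" where
  "box l u x y = {\<omega> \<in> space M. S 0 \<omega> \<in> {l<..u} \<and> S 1 \<omega> \<in> {-9 * s..x * s} \<and> S 2 \<omega> \<in> {y * s<..}}"

lemma box_event [measurable]: "box l u x y \<in> events"
  unfolding box_def by measurable

text \<open>By independence the box probability is a product. The parameters \<open>w\<close>,
  \<open>e\<close>, \<open>b\<close>, \<open>c\<close> take numerical lower bounds for the strip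
  width, the exponential and the two remaining factors; \<open>b\<close> must leave room for the
  truncation loss.\<close>

lemma prob_box:
  assumes "0 \<le> l" "l \<le> u" "u\<^sup>2 / 1.92 \<le> z" "-9 \<le> x"
    and w: "w \<le> u - l" "0 \<le> w" and e: "e \<le> exp (- z)" "0 \<le> e"
    and b: "b + 1 / 81 \<le> measure std_normal {- x<..}" "0 \<le> b"
    and c: "c \<le> measure std_normal {y<..}" "0 \<le> c"
  shows "w * (0.398 * e) * b * c \<le> prob (box l u x y)"
proof -
  have s0: "0 < s" using s by simp
  have 0: "w * (0.398 * e) \<le> prob {\<omega> \<in> space M. S 0 \<omega> \<in> {l<..u}}"
    using w e by (intro order_trans[OF _ prob_S0_strip[OF assms(1-3)]] mult_mono) auto
  have "{\<omega> \<in> space M. S 1 \<omega> \<in> {-9 * s..x * s}} = {\<omega> \<in> space M. S 1 \<omega> / s \<in> {-9..x}}"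
    using s0 by (auto simp: field_simps)
  then have 1: "b \<le> prob {\<omega> \<in> space M. S 1 \<omega> \<in> {-9 * s..x * s}}"
    using normal_prob_scaled[OF S1 s0, of "{-9..x}"] measure_std_normal_truncated[of x] assms by simp
  have "{\<omega> \<in> space M. S 2 \<omega> \<in> {y * s<..}} = {\<omega> \<in> space M. S 2 \<omega> / s \<in> {y<..}}"
    using s0 by (auto simp: field_simps)
  then have 2: "c \<le> prob {\<omega> \<in> space M. S 2 \<omega> \<in> {y * s<..}}"
    using normal_prob_scaled[OF S2 s0, of "{y<..}"] c by simp
  have "prob (box l u x y) = prob {\<omega> \<in> space M. S 0 \<omega> \<in> {l<..u}}
      * prob {\<omega> \<in> space M. S 1 \<omega> \<in> {-9 * s..x * s}} * prob {\<omega> \<in> space M. S 2 \<omega> \<in> {y * s<..}}"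
    unfolding box_def by (rule indep_vars_prob_3[OF indep]) auto
  moreover have "w * (0.398 * e) * b * c \<le> \<dots>"
    using 0 1 2 assms by (intro mult_mono mult_nonneg_nonneg measure_nonneg) simp_all
  ultimately show ?thesis by simp
qed

text \<open>Four strips of width \<open>s / 2\<close> cover the values of \<open>S 0\<close> within
  \<open>s\<close> of 1. In a strip from \<open>l\<close> to \<open>u\<close>, the cut-offs solve
  \<open>u + x * s = 1\<close> and \<open>l + y * s = 1\<close>, so the whole box satisfies the
  first upper constraint and violates the second.\<close>

lemma prob_exit_upper:
  "0.011 \<le> prob {\<omega> \<in> space M. \<bar>S 0 \<omega> + S 1 \<omega>\<bar> \<le> 1 \<and> 1 < S 0 \<omega> + S 2 \<omega>}"
    (is "_ \<le> prob ?E")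
proof -
  define w where "w = s / 2"
  have w: "0.0995 \<le> w" "w \<le> 0.1" "s = 2 * w" using s by (auto simp: w_def)
  note num = measure_std_normal_numeric measure_std_normal_nonneg_half
  \<comment> \<open>The exponents bound \<open>u\<^sup>2 / 1.92\<close> at the right ends
    \<open>1 - w\<close>, \<open>1\<close>, \<open>1 + w\<close>, \<open>1 + 2 * w\<close> of the
    strips.\<close>
  have exps: "0.654 \<le> exp (- 0.4225 :: real)" "0.591 \<le> exp (- (1 / 1.92) :: real)"
    "0.526 \<le> exp (- (1.21 / 1.92) :: real)" "0.46 \<le> exp (- 0.75 :: real)"
    using exp_ge_cubic[of "- 0.4225"] exp_ge_cubic[of "- (1 / 1.92)"]
      exp_ge_cubic[of "- (1.21 / 1.92)"] exp_ge_cubic[of "- 0.75"]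
    by (simp_all add: power2_eq_square power3_eq_cube)
  have sq: "u\<^sup>2 \<le> v\<^sup>2" if "0 \<le> u" "u \<le> v" for u v :: real using that by (rule power_mono[rotated])
  let ?B1 = "box (1 - 2 * w) (1 - w) (1/2) 1" and ?B2 = "box (1 - w) 1 0 (1/2)"
    and ?B3 = "box 1 (1 + w) (- (1/2)) 0" and ?B4 = "box (1 + w) (1 + 2 * w) (-1) (- (1/2))"
  have "(1 - w)\<^sup>2 \<le> 0.9005\<^sup>2" "(1 + w)\<^sup>2 \<le> 1.1\<^sup>2" "(1 + 2 * w)\<^sup>2 \<le> 1.2\<^sup>2"
    using w by (auto intro!: sq)
  then have sqs: "(1 - w)\<^sup>2 / 1.92 \<le> 0.4225" "(1 + w)\<^sup>2 / 1.92 \<le> 1.21 / 1.92" "(1 + 2 * w)\<^sup>2 / 1.92 \<le> 0.75"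
    by (auto simp: power2_eq_square)
  have 1: "0.0995 * (0.398 * 0.654) * 0.661 * 0.1575 \<le> prob ?B1"
    by (rule prob_box[where z = "0.4225"]) (use w sqs exps num in auto)
  have 2: "0.0995 * (0.398 * 0.591) * 0.487 * 0.308 \<le> prob ?B2"
    by (rule prob_box[where z = "1 / 1.92"]) (use w sqs exps num in auto)
  have 3: "0.0995 * (0.398 * 0.526) * 0.295 * 0.5 \<le> prob ?B3"
    by (rule prob_box[where z = "1.21 / 1.92"]) (use w sqs exps num in auto)
  have 4: "0.0995 * (0.398 * 0.46) * 0.145 * 0.674 \<le> prob ?B4"
    by (rule prob_box[where z = "0.75"]) (use w sqs exps num in auto)
  \<comment> \<open>In every box \<open>S 0 + S 1\<close> exceeds \<open>1 - s - 9 * s\<close>,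
    which is at least \<open>-1\<close> exactly because \<open>s\<close> is at most 0.2.\<close>
  have sub: "?B1 \<subseteq> ?E" "?B2 \<subseteq> ?E" "?B3 \<subseteq> ?E" "?B4 \<subseteq> ?E"
    unfolding box_def using w by auto
  have dis: "?B1 \<inter> (?B2 \<union> (?B3 \<union> ?B4)) = {}" "?B2 \<inter> (?B3 \<union> ?B4) = {}" "?B3 \<inter> ?B4 = {}"
    unfolding box_def using w by auto
  have "prob (?B1 \<union> (?B2 \<union> (?B3 \<union> ?B4))) = prob ?B1 + prob (?B2 \<union> (?B3 \<union> ?B4))"
    by (intro finite_measure_Union dis) auto
  also have "prob (?B2 \<union> (?B3 \<union> ?B4)) = prob ?B2 + prob (?B3 \<union> ?B4)"
    by (intro finite_measure_Union dis) auto
  also have "prob (?B3 \<union> ?B4) = prob ?B3 + prob ?B4"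
    by (intro finite_measure_Union dis) auto
  finally have "0.011 \<le> prob (?B1 \<union> (?B2 \<union> (?B3 \<union> ?B4)))"
    using 1 2 3 4 by simp
  also have "\<dots> \<le> prob ?E"
    using sub by (intro finite_measure_mono) auto
  finally show ?thesis .
qed

text \<open>Centred normals are symmetric; this transfers the estimate for leaving above 1 to
  leaving below \<open>-1\<close>.\<close>

lemma correlated_row_uminus: "correlated_row M (\<lambda>i \<omega>. - S i \<omega>) s"
proof
  show "indep_vars (\<lambda>_. borel) (\<lambda>i \<omega>. - S i \<omega>) {0, 1, 2}"
    by (rule indep_vars_compose2[OF indep]) auto
  have neg: "distributed M lborel (\<lambda>\<omega>. - X \<omega>) (normal_density 0 \<sigma>)"
    if "distributed M lborel X (normal_density 0 \<sigma>)" "0 < \<sigma>" for X \<sigma>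
    using normal_density_affine[OF that, of "-1" 0] by simp
  have "0 < sqrt (1 - s\<^sup>2)" using s_sq by simp
  then show "distributed M lborel (\<lambda>\<omega>. - S 0 \<omega>) (normal_density 0 (sqrt (1 - s\<^sup>2)))"
    "distributed M lborel (\<lambda>\<omega>. - S 1 \<omega>) (normal_density 0 s)"
    "distributed M lborel (\<lambda>\<omega>. - S 2 \<omega>) (normal_density 0 s)"
    using neg S0 S1 S2 s by auto
qed (use s in auto)

text \<open>The variances \<open>1 - s\<^sup>2\<close> and \<open>s\<^sup>2\<close> add up to 1, so
  the sum is standard normal.\<close>

lemma prob_first: "prob {\<omega> \<in> space M. \<bar>S 0 \<omega> + S 1 \<omega>\<bar> \<le> 1} \<le> 0.685"
proof -
  have "indep_vars (\<lambda>_. borel) S {0, 1}" by (rule indep_vars_subset[OF indep]) auto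
  have "distributed M lborel (\<lambda>\<omega>. \<Sum>i\<in>{0, 1}. S i \<omega>)
      (normal_density (\<Sum>i\<in>{0, 1::nat}. 0) (sqrt (\<Sum>i\<in>{0, 1::nat}. (if i = 0 then sqrt (1 - s\<^sup>2) else s)\<^sup>2)))"
  proof (rule sum_indep_normal)
    fix i :: nat assume "i \<in> {0, 1}"
    then show "0 < (if i = 0 then sqrt (1 - s\<^sup>2) else s)" using s s_sq by auto
    from \<open>i \<in> {0, 1}\<close> show "distributed M lborel (S i) (normal_density 0 (if i = 0 then sqrt (1 - s\<^sup>2) else s))"
      using S0 S1 by auto
  qed (use \<open>indep_vars (\<lambda>_. borel) S {0, 1}\<close> in auto)
  then have "distributed M lborel (\<lambda>\<omega>. S 0 \<omega> + S 1 \<omega>) std_normal_density"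
    using s_sq by simp
  from distributed_std_normal_prob[OF this, of "{-1..1}"]
  have "prob {\<omega> \<in> space M. S 0 \<omega> + S 1 \<omega> \<in> {-1..1}} \<le> 0.685"
    using measure_std_normal_numeric(1) by simp
  also have "{\<omega> \<in> space M. S 0 \<omega> + S 1 \<omega> \<in> {-1..1}} = {\<omega> \<in> space M. \<bar>S 0 \<omega> + S 1 \<omega>\<bar> \<le> 1}"
    by auto
  finally show ?thesis .
qed

text \<open>Given the first constraint, the second sum stays inside, leaves above or leaves below;
  removing the two exits leaves at most \<open>0.685 - 2 * 0.011 = 0.663\<close>.\<close>

lemma prob_both:
  "prob {\<omega> \<in> space M. \<bar>S 0 \<omega> + S 1 \<omega>\<bar> \<le> 1 \<and> \<bar>S 0 \<omega> + S 2 \<omega>\<bar> \<le> 1} \<le> 0.664"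
    (is "prob ?E \<le> _")
proof -
  let ?U = "{\<omega> \<in> space M. \<bar>S 0 \<omega> + S 1 \<omega>\<bar> \<le> 1 \<and> 1 < S 0 \<omega> + S 2 \<omega>}"
  let ?L = "{\<omega> \<in> space M. \<bar>S 0 \<omega> + S 1 \<omega>\<bar> \<le> 1 \<and> S 0 \<omega> + S 2 \<omega> < - 1}"
  have "{\<omega> \<in> space M. \<bar>(- S 0 \<omega>) + (- S 1 \<omega>)\<bar> \<le> 1 \<and> 1 < (- S 0 \<omega>) + (- S 2 \<omega>)} = ?L"
    by auto
  with correlated_row.prob_exit_upper[OF correlated_row_uminus] have L: "0.011 \<le> prob ?L" by (simp only:)
  have "prob (?E \<union> (?U \<union> ?L)) = prob ?E + prob (?U \<union> ?L)"
    by (rule finite_measure_Union) auto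
  also have "prob (?U \<union> ?L) = prob ?U + prob ?L"
    by (rule finite_measure_Union) auto
  also have "?E \<union> (?U \<union> ?L) = {\<omega> \<in> space M. \<bar>S 0 \<omega> + S 1 \<omega>\<bar> \<le> 1}"
    by auto
  finally show ?thesis using L prob_exit_upper prob_first by simp
qed

end

section \<open>Gaussian matrices\<close>

lemma space_gaussian_matrix [simp]: "space (gaussian_matrix m n) = matrices m n"
  by (simp add: gaussian_matrix_def matrices_def space_PiM)

lemma prob_space_gaussian_matrix: "prob_space (gaussian_matrix m n)"
  unfolding gaussian_matrix_def by (intro prob_space_PiM prob_space_std_normal)

lemma gaussian_matrix_entry_measurable [measurable]:
  "p \<in> {1..m} \<times> {1..n} \<Longrightarrow> (\<lambda>\<omega>. \<omega> p) \<in> borel_measurable (gaussian_matrix m n)"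
proof -
  assume "p \<in> {1..m} \<times> {1..n}"
  then have "(\<lambda>\<omega>. \<omega> p) \<in> gaussian_matrix m n \<rightarrow>\<^sub>M std_normal"
    unfolding gaussian_matrix_def by (rule measurable_component_singleton)
  then show ?thesis by (simp cong: measurable_cong_sets)
qed

lemma distributed_gaussian_matrix_entry:
  assumes "p \<in> {1..m} \<times> {1..n}"
  shows "distributed (gaussian_matrix m n) lborel (\<lambda>\<omega>. \<omega> p) std_normal_density"
proof -
  have "distr (gaussian_matrix m n) lborel (\<lambda>\<omega>. \<omega> p) = distr (gaussian_matrix m n) std_normal (\<lambda>\<omega>. \<omega> p)"
    by (rule distr_cong) auto
  also have "\<dots> = std_normal"
    unfolding gaussian_matrix_def using assms
    by (intro distr_PiM_component prob_space_std_normal) auto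
  finally show ?thesis
    using assms by (simp add: distributed_def std_normal_def)
qed

text \<open>Independence is read off the joint law: the coordinates together form the identity map,
  whose law is the product measure by construction.\<close>

lemma indep_vars_gaussian_matrix:
  assumes "1 \<le> m" "1 \<le> n"
  shows "prob_space.indep_vars (gaussian_matrix m n) (\<lambda>_. borel) (\<lambda>p \<omega>. \<omega> p) ({1..m} \<times> {1..n})"
proof -
  let ?I = "{1..m} \<times> {1..n}"
  interpret prob_space "gaussian_matrix m n" by (rule prob_space_gaussian_matrix)
  have "indep_vars (\<lambda>_. std_normal) (\<lambda>p \<omega>. \<omega> p) ?I"
  proof (subst indep_vars_iff_distr_eq_PiM')
    show "?I \<noteq> {}" using assms by auto
    show "(\<lambda>\<omega>. \<omega> p) \<in> gaussian_matrix m n \<rightarrow>\<^sub>M std_normal" if "p \<in> ?I" for p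
      using that unfolding gaussian_matrix_def by (rule measurable_component_singleton)
    have "distr (gaussian_matrix m n) (\<Pi>\<^sub>M i\<in>?I. std_normal) (\<lambda>\<omega>. \<lambda>i\<in>?I. \<omega> i)
        = distr (gaussian_matrix m n) (gaussian_matrix m n) (\<lambda>\<omega>. \<omega>)"
      by (rule distr_cong) (auto simp: gaussian_matrix_def space_PiM PiE_def extensional_restrict)
    also have "\<dots> = (\<Pi>\<^sub>M i\<in>?I. std_normal)"
      by (simp add: distr_id2 gaussian_matrix_def)
    also have "\<dots> = (\<Pi>\<^sub>M i\<in>?I. distr (gaussian_matrix m n) std_normal (\<lambda>\<omega>. \<omega> i))"
      unfolding gaussian_matrix_def
      by (intro PiM_cong refl distr_PiM_component[symmetric] prob_space_std_normal) auto
    finally show "distr (gaussian_matrix m n) (\<Pi>\<^sub>M i\<in>?I. std_normal) (\<lambda>\<omega>. \<lambda>i\<in>?I. \<omega> i)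
        = (\<Pi>\<^sub>M i\<in>?I. distr (gaussian_matrix m n) std_normal (\<lambda>\<omega>. \<omega> i))" .
  qed
  then show ?thesis
    by (rule indep_vars_compose2[where Y = "\<lambda>_ x. x"]) (simp add: measurable_ident_sets)
qed

text \<open>Signs do not affect a centred normal, so coefficients of equal modulus give a variance
  depending only on the number of entries. It is applied to sign vectors divided by
  \<open>sqrt n\<close>.\<close>

lemma gaussian_matrix_linear_normal:
  assumes "finite K" "K \<noteq> {}" "K \<subseteq> {1..m} \<times> {1..n}" "0 < \<sigma>"
    and c: "\<And>p. p \<in> K \<Longrightarrow> \<bar>c p\<bar> = \<sigma>"
  shows "distributed (gaussian_matrix m n) lborel (\<lambda>\<omega>. \<Sum>p\<in>K. c p * \<omega> p)
    (normal_density 0 (sqrt (real (card K) * \<sigma>\<^sup>2)))"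
proof -
  interpret prob_space "gaussian_matrix m n" by (rule prob_space_gaussian_matrix)
  have "1 \<le> m" "1 \<le> n" using assms by auto
  note ind = indep_vars_gaussian_matrix[OF this]
  have "distributed (gaussian_matrix m n) lborel (\<lambda>\<omega>. \<Sum>p\<in>K. c p * \<omega> p)
      (normal_density (\<Sum>p\<in>K. 0) (sqrt (\<Sum>p\<in>K. \<sigma>\<^sup>2)))"
  proof (rule sum_indep_normal)
    show "indep_vars (\<lambda>_. borel) (\<lambda>p \<omega>. c p * \<omega> p) K"
      by (rule indep_vars_compose2[OF indep_vars_subset[OF ind assms(3)]]) auto
    show "distributed (gaussian_matrix m n) lborel (\<lambda>\<omega>. c p * \<omega> p) (normal_density 0 \<sigma>)" if "p \<in> K" for p
    proof -
      have "distributed (gaussian_matrix m n) lborel (\<lambda>\<omega>. \<omega> p) std_normal_density"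
        using that assms(3) by (intro distributed_gaussian_matrix_entry) auto
      moreover have "c p \<noteq> 0" using c[OF that] assms(4) by auto
      ultimately show ?thesis
        using normal_density_affine[of "\<lambda>\<omega>. \<omega> p" 0 1 "c p" 0] c[OF that] by simp
    qed
  qed (use assms in auto)
  then show ?thesis by simp
qed

section \<open>Both constraints over all rows, for a fixed pair of sign vectors\<close>

text \<open>
  A single sign vector of length \<open>n + d\<close> encodes two sign vectors of length \<open>n\<close> that agree in
  the first \<open>n - d\<close> entries.
\<close>

definition both_rows_event :: "nat \<Rightarrow> nat \<Rightarrow> nat \<Rightarrow> (nat \<Rightarrow> real) \<Rightarrow> (nat \<times> nat \<Rightarrow> real) set" where
  "both_rows_event m n d \<tau> = {\<omega> \<in> matrices m (n + d). \<forall>i\<in>{1..m}.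
       \<bar>(\<Sum>j\<in>{1..n - d}. \<omega> (i, j) * \<tau> j) + (\<Sum>j\<in>{n - d + 1..n}. \<omega> (i, j) * \<tau> j)\<bar> \<le> sqrt (real n) \<and>
       \<bar>(\<Sum>j\<in>{1..n - d}. \<omega> (i, j) * \<tau> j) + (\<Sum>j\<in>{n + 1..n + d}. \<omega> (i, j) * \<tau> j)\<bar> \<le> sqrt (real n)}"

lemma both_rows_event_sets:
  assumes "d < n"
  shows "both_rows_event m n d \<tau> \<in> sets (gaussian_matrix m (n + d))"
proof -
  let ?G = "gaussian_matrix m (n + d)"
  have sums: "(\<lambda>\<omega>. \<Sum>j\<in>K. \<omega> (i, j) * \<tau> j) \<in> borel_measurable ?G"
    if "i \<in> {1..m}" "K \<subseteq> {1..n + d}" for i K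
    using that by (intro borel_measurable_sum borel_measurable_times gaussian_matrix_entry_measurable) auto
  have "{\<omega> \<in> space ?G. \<forall>i\<in>{1..m}.
       \<bar>(\<Sum>j\<in>{1..n - d}. \<omega> (i, j) * \<tau> j) + (\<Sum>j\<in>{n - d + 1..n}. \<omega> (i, j) * \<tau> j)\<bar> \<le> sqrt (real n) \<and>
       \<bar>(\<Sum>j\<in>{1..n - d}. \<omega> (i, j) * \<tau> j) + (\<Sum>j\<in>{n + 1..n + d}. \<omega> (i, j) * \<tau> j)\<bar> \<le> sqrt (real n)} \<in> sets ?G"
    by (intro sets.sets_Collect_finite_All sets.sets_Collect_conj borel_measurable_le
        borel_measurable_abs borel_measurable_add sums borel_measurable_const) auto
  then show ?thesis by (simp add: both_rows_event_def)
qed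

text \<open>Different rows use disjoint sets of independent entries, and each row is a
  \<open>correlated_row\<close>, so the bound for one row is raised to the power
  \<open>m\<close>.\<close>

lemma prob_both_rows:
  fixes \<tau> :: "nat \<Rightarrow> real"
  assumes m: "1 \<le> m" and d: "1 \<le> d" "d < n"
    and s: "s = sqrt (real d / real n)" "0.199 \<le> s" "s \<le> 0.2"
    and \<tau>: "\<And>j. j \<in> {1..n + d} \<Longrightarrow> \<bar>\<tau> j\<bar> = 1"
  shows "measure (gaussian_matrix m (n + d)) (both_rows_event m n d \<tau>) \<le> 0.664 ^ m"
proof -
  define N where "N = n + d"
  interpret prob_space "gaussian_matrix m N" by (rule prob_space_gaussian_matrix)
  \<comment> \<open>The column blocks are the shared columns, the original last \<open>d\<close>
    columns and their fresh replacements.\<close>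
  define J where "J k = (if k = (0::nat) then {1..n - d} else if k = 1 then {n - d + 1..n} else {n + 1..n + d})" for k
  define c where "c p = \<tau> (snd p) / sqrt (real n)" for p :: "nat \<times> nat"
  define T where "T i k \<omega> = (\<Sum>p\<in>{i} \<times> J k. c p * \<omega> p)" for i k and \<omega> :: "nat \<times> nat \<Rightarrow> real"
  define R where "R i = {i} \<times> {1..N}" for i :: nat
  have JN: "J k \<subseteq> {1..N}" "finite (J k)" "J k \<noteq> {}" for k
    using d by (auto simp: J_def N_def)
  have n: "0 < n" using d by simp
  have ind: "indep_vars (\<lambda>_. borel) (\<lambda>p \<omega>. \<omega> p) ({1..m} \<times> {1..N})"
    using m d by (intro indep_vars_gaussian_matrix) (auto simp: N_def)
  have row: "correlated_row (gaussian_matrix m N) (T i) s" if i: "i \<in> {1..m}" for i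
  proof
    have "indep_vars (\<lambda>k. PiM ({i} \<times> J k) (\<lambda>_. borel)) (\<lambda>k \<omega>. restrict (\<lambda>p. \<omega> p) ({i} \<times> J k)) {0, 1, 2}"
    proof (rule indep_vars_restrict[OF ind])
      show "{i} \<times> J k \<subseteq> {1..m} \<times> {1..N}" for k using JN(1)[of k] i by auto
      show "disjoint_family_on (\<lambda>k. {i} \<times> J k) {0, 1, 2}"
        using d by (auto simp: disjoint_family_on_def J_def)
    qed
    then have "indep_vars (\<lambda>_. borel) (\<lambda>k \<omega>. \<Sum>p\<in>{i} \<times> J k. c p * restrict (\<lambda>p. \<omega> p) ({i} \<times> J k) p) {0, 1, 2}"
      by (rule indep_vars_compose2[where Y = "\<lambda>k \<omega>. \<Sum>p\<in>{i} \<times> J k. c p * \<omega> p"]) measurable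
    then show "indep_vars (\<lambda>_. borel) (T i) {0, 1, 2}"
      by (simp add: T_def[abs_def])
    have dist: "distributed (gaussian_matrix m N) lborel (T i k)
        (normal_density 0 (sqrt (real (card (J k)) / real n)))" for k
    proof -
      have "distributed (gaussian_matrix m N) lborel (\<lambda>\<omega>. \<Sum>p\<in>{i} \<times> J k. c p * \<omega> p)
          (normal_density 0 (sqrt (real (card ({i} \<times> J k)) * (1 / sqrt (real n))\<^sup>2)))"
      proof (rule gaussian_matrix_linear_normal)
        show "{i} \<times> J k \<subseteq> {1..m} \<times> {1..N}" using JN(1)[of k] i by auto
        show "\<bar>c p\<bar> = 1 / sqrt (real n)" if "p \<in> {i} \<times> J k" for p
          using \<tau>[of "snd p"] JN(1)[of k] that by (auto simp: c_def N_def)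
      qed (use JN n in auto)
      then show ?thesis
        using n by (simp add: T_def[abs_def] card_cartesian_product power_divide)
    qed
    have "s\<^sup>2 = real d / real n" using s by simp
    then have "real (n - d) / real n = 1 - s\<^sup>2"
      using d n by (simp add: of_nat_diff diff_divide_distrib)
    then show "distributed (gaussian_matrix m N) lborel (T i 0) (normal_density 0 (sqrt (1 - s\<^sup>2)))"
      using dist[of 0] by (simp add: J_def)
    show "distributed (gaussian_matrix m N) lborel (T i 1) (normal_density 0 s)"
      using dist[of 1] d s(1) by (simp add: J_def)
    show "distributed (gaussian_matrix m N) lborel (T i 2) (normal_density 0 s)"
      using dist[of 2] d s(1) by (simp add: J_def)
  qed (use s in auto)
  \<comment> \<open>Stated over the entries of row \<open>i\<close> alone, so that independence of
    the restrictions to rows applies.\<close>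
  define E where "E i = {x \<in> space (PiM (R i) (\<lambda>_. borel)). \<bar>T i 0 x + T i 1 x\<bar> \<le> 1 \<and> \<bar>T i 0 x + T i 2 x\<bar> \<le> 1}" for i
  have T_restrict: "T i k (restrict \<omega> (R i)) = T i k \<omega>" for i k \<omega>
    using JN(1)[of k] unfolding T_def R_def by (intro sum.cong) auto
  have T_meas: "T i k \<in> borel_measurable (PiM (R i) (\<lambda>_. borel))" for i k
    unfolding T_def[abs_def] using JN(1)[of k]
    by (intro borel_measurable_sum borel_measurable_times borel_measurable_const measurable_component_singleton)
      (auto simp: R_def)
  have E_sets: "E i \<in> sets (PiM (R i) (\<lambda>_. borel))" for i
    unfolding E_def using T_meas[of i] by measurable
  have pre: "(\<lambda>\<omega>. restrict (\<lambda>p. \<omega> p) (R i)) -` E i \<inter> space (gaussian_matrix m N)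
      = {\<omega> \<in> space (gaussian_matrix m N). \<bar>T i 0 \<omega> + T i 1 \<omega>\<bar> \<le> 1 \<and> \<bar>T i 0 \<omega> + T i 2 \<omega>\<bar> \<le> 1}" for i
    by (auto simp: E_def T_restrict space_PiM)
  have "prob (\<Inter>i\<in>{1..m}. (\<lambda>\<omega>. restrict (\<lambda>p. \<omega> p) (R i)) -` E i \<inter> space (gaussian_matrix m N))
      = (\<Prod>i\<in>{1..m}. prob ((\<lambda>\<omega>. restrict (\<lambda>p. \<omega> p) (R i)) -` E i \<inter> space (gaussian_matrix m N)))"
  proof (rule indep_varsD_finite)
    show "indep_vars (\<lambda>i. PiM (R i) (\<lambda>_. borel)) (\<lambda>i \<omega>. restrict (\<lambda>p. \<omega> p) (R i)) {1..m}"
      by (intro indep_vars_restrict[OF ind]) (auto simp: disjoint_family_on_def R_def)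
  qed (use m E_sets in auto)
  also have "\<dots> \<le> (\<Prod>i\<in>{1..m}. 0.664)"
    unfolding pre by (intro prod_mono conjI measure_nonneg correlated_row.prob_both[OF row]) auto
  finally have le: "prob (\<Inter>i\<in>{1..m}. (\<lambda>\<omega>. restrict (\<lambda>p. \<omega> p) (R i)) -` E i \<inter> space (gaussian_matrix m N)) \<le> 0.664 ^ m"
    by simp
  have scale: "\<bar>x\<bar> \<le> sqrt (real n) \<longleftrightarrow> \<bar>x / sqrt (real n)\<bar> \<le> 1" for x
    using n by (simp add: abs_divide)
  have T_eq: "T i k \<omega> = (\<Sum>j\<in>J k. \<omega> (i, j) * \<tau> j) / sqrt (real n)" for i k \<omega>
  proof -
    have "T i k \<omega> = (\<Sum>j\<in>J k. c (i, j) * \<omega> (i, j))"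
      unfolding T_def by (subst sum.cartesian_product[symmetric, of "\<lambda>i j. c (i, j) * \<omega> (i, j)", simplified])
        (auto simp: case_prod_beta)
    then show ?thesis by (simp add: c_def sum_divide_distrib mult.commute)
  qed
  have "{\<omega> \<in> matrices m N. \<forall>i\<in>{1..m}.
       \<bar>(\<Sum>j\<in>J 0. \<omega> (i, j) * \<tau> j) + (\<Sum>j\<in>J 1. \<omega> (i, j) * \<tau> j)\<bar> \<le> sqrt (real n) \<and>
       \<bar>(\<Sum>j\<in>J 0. \<omega> (i, j) * \<tau> j) + (\<Sum>j\<in>J 2. \<omega> (i, j) * \<tau> j)\<bar> \<le> sqrt (real n)}
     = (\<Inter>i\<in>{1..m}. (\<lambda>\<omega>. restrict (\<lambda>p. \<omega> p) (R i)) -` E i \<inter> space (gaussian_matrix m N))"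
    unfolding pre scale T_eq using m by (auto simp: add_divide_distrib)
  with le show ?thesis by (simp add: both_rows_event_def J_def N_def)
qed

section \<open>Resampling the last columns\<close>

lemma card_cube: "card (cube n) = 2 ^ n"
  unfolding cube_def by (simp add: card_PiE numeral_2_eq_2)

text \<open>Selecting distinct entries of a larger Gaussian matrix yields a Gaussian matrix; both
  runs of the algorithm receive their input this way.\<close>

lemma distr_gaussian_matrix_reindex:
  assumes "inj_on f ({1..m} \<times> {1..n})" "f \<in> {1..m} \<times> {1..n} \<rightarrow> {1..k} \<times> {1..l}"
  shows "distr (gaussian_matrix k l) (gaussian_matrix m n) (\<lambda>\<omega>. \<lambda>p\<in>{1..m} \<times> {1..n}. \<omega> (f p)) = gaussian_matrix m n"
  unfolding gaussian_matrix_def by (rule distr_PiM_reindex[OF prob_space_std_normal assms])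

lemma reindex_measurable:
  assumes "f \<in> {1..m} \<times> {1..n} \<rightarrow> {1..k} \<times> {1..l}"
  shows "(\<lambda>\<omega>. \<lambda>p\<in>{1..m} \<times> {1..n}. \<omega> (f p)) \<in> gaussian_matrix k l \<rightarrow>\<^sub>M gaussian_matrix m n"
  unfolding gaussian_matrix_def using assms
  by (intro measurable_restrict measurable_component_singleton) auto

lemma abs_mat_vec_le_of_success:
  assumes "X \<in> success_event m n A" "i \<in> {1..m}"
  shows "\<bar>\<Sum>j\<in>{1..n}. X (i, j) * A X j\<bar> \<le> sqrt (real n)"
proof -
  have "\<bar>mat_vec m n X (A X) i\<bar> \<le> sup_norm m (mat_vec m n X (A X))"
    unfolding sup_norm_def using assms by (intro Max_ge) auto
  then show ?thesis using assms by (simp add: success_event_def mat_vec_def)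
qed

text \<open>One matrix with \<open>n + d\<close> columns carries both inputs: the first is its
  leading \<open>n\<close> columns, the second reads its last \<open>d\<close> columns from
  positions \<open>n + 1\<close> to \<open>n + d\<close>.\<close>

definition resample :: "nat \<Rightarrow> nat \<Rightarrow> nat \<times> nat \<Rightarrow> nat \<times> nat" where
  "resample n d p = (fst p, if snd p \<le> n - d then snd p else snd p + d)"

text \<open>For \<open>t\<close> up to \<open>n - d\<close> the function \<open>f t\<close> sees the
  same columns in both runs, so the outputs agree there and fit into one sign vector.\<close>

lemma success_both_subset:
  assumes alg: "online_algorithm p m n A" and d: "d < n"
    and \<omega>: "\<omega> \<in> matrices m (n + d)"
    and X1: "X1 = (\<lambda>p\<in>{1..m} \<times> {1..n}. \<omega> p)" "X1 \<in> success_event m n A"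
    and X2: "X2 = (\<lambda>p\<in>{1..m} \<times> {1..n}. \<omega> (resample n d p))" "X2 \<in> success_event m n A"
  shows "\<exists>\<tau>\<in>cube (n + d). \<omega> \<in> both_rows_event m n d \<tau>"
proof -
  obtain f :: "nat \<Rightarrow> (nat \<Rightarrow> nat \<Rightarrow> real) \<Rightarrow> real" where
    f: "\<And>t X. t \<in> {1..n} \<Longrightarrow> X \<in> matrices m n \<Longrightarrow> A X t = f t (\<lambda>s\<in>{1..t}. column m X s)"
    using alg unfolding online_algorithm_def by blast
  have X_mat: "X1 \<in> matrices m n" "X2 \<in> matrices m n"
    using X1 X2 by (auto simp: success_event_def)
  have A_cube: "A X1 \<in> cube n" "A X2 \<in> cube n"
    using alg X_mat by (auto simp: online_algorithm_def)
  have agree: "A X1 t = A X2 t" if t: "t \<in> {1..n - d}" for t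
  proof -
    have "column m X1 s = column m X2 s" if "s \<in> {1..t}" for s
      using that t by (auto simp: column_def X1 X2 resample_def fun_eq_iff)
    then have "(\<lambda>s\<in>{1..t}. column m X1 s) = (\<lambda>s\<in>{1..t}. column m X2 s)"
      by (auto simp: fun_eq_iff)
    then show ?thesis using f[of t] X_mat t by auto
  qed
  \<comment> \<open>The whole first output, followed by the last \<open>d\<close> signs of the
    second; the shift by \<open>d\<close> matches \<open>resample\<close>.\<close>
  define \<tau> where "\<tau> = (\<lambda>j\<in>{1..n + d}. if j \<le> n then A X1 j else A X2 (j - d))"
  have "\<tau> \<in> cube (n + d)"
    unfolding cube_def
  proof (rule PiE_I)
    fix j assume "j \<in> {1..n + d}"
    then have "\<tau> j = A X1 j \<and> j \<in> {1..n} \<or> \<tau> j = A X2 (j - d) \<and> j - d \<in> {1..n}"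
      using d by (auto simp: \<tau>_def)
    then show "\<tau> j \<in> {-1, 1}"
      using A_cube PiE_mem unfolding cube_def by metis
  qed (auto simp: \<tau>_def)
  moreover have "\<omega> \<in> both_rows_event m n d \<tau>"
    unfolding both_rows_event_def
  proof (intro CollectI conjI ballI \<omega>)
    fix i assume i: "i \<in> {1..m}"
    have split: "(\<Sum>j\<in>{1..n}. g j) = (\<Sum>j\<in>{1..n - d}. g j) + (\<Sum>j\<in>{n - d + 1..n}. g j)" for g :: "nat \<Rightarrow> real"
      using d sum.ub_add_nat[of 1 "n - d" g d] by simp
    have "(\<Sum>j\<in>{1..n}. X1 (i, j) * A X1 j) = (\<Sum>j\<in>{1..n}. \<omega> (i, j) * \<tau> j)"
      using i by (intro sum.cong) (auto simp: X1(1) \<tau>_def)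
    then show "\<bar>(\<Sum>j\<in>{1..n - d}. \<omega> (i, j) * \<tau> j) + (\<Sum>j\<in>{n - d + 1..n}. \<omega> (i, j) * \<tau> j)\<bar> \<le> sqrt (real n)"
      using abs_mat_vec_le_of_success[OF X1(2) i] by (simp only: split)
    have "(\<Sum>j\<in>{1..n - d}. X2 (i, j) * A X2 j) = (\<Sum>j\<in>{1..n - d}. \<omega> (i, j) * \<tau> j)"
      using i agree by (intro sum.cong) (auto simp: X2(1) \<tau>_def resample_def)
    moreover have "(\<Sum>j\<in>{n - d + 1..n}. X2 (i, j) * A X2 j) = (\<Sum>j\<in>{n - d + 1..n}. \<omega> (i, j + d) * \<tau> (j + d))"
      using i d by (intro sum.cong) (auto simp: X2(1) \<tau>_def resample_def)
    moreover have "\<dots> = (\<Sum>j\<in>{n + 1..n + d}. \<omega> (i, j) * \<tau> j)"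
      using d sum.shift_bounds_cl_nat_ivl[of "\<lambda>j. \<omega> (i, j) * \<tau> j" "n - d + 1" d n] by simp
    ultimately show "\<bar>(\<Sum>j\<in>{1..n - d}. \<omega> (i, j) * \<tau> j) + (\<Sum>j\<in>{n + 1..n + d}. \<omega> (i, j) * \<tau> j)\<bar> \<le> sqrt (real n)"
      using abs_mat_vec_le_of_success[OF X2(2) i] by (simp only: split)
  qed
  ultimately show ?thesis by blast
qed

section \<open>The first-moment inequality and the contradiction for large dimension\<close>

text \<open>Each run has the law of a Gaussian matrix and fails with probability at most
  \<open>p\<close>, so both succeed with probability at least \<open>1 - 2 * p\<close>; a union
  bound over sign vectors limits this from above.\<close>

lemma online_algorithm_first_moment:
  assumes alg: "online_algorithm p m n A" and m: "1 \<le> m" and d: "1 \<le> d" "d < n"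
    and s: "s = sqrt (real d / real n)" "0.199 \<le> s" "s \<le> 0.2"
  shows "1 - 2 * p \<le> 2 ^ (n + d) * 0.664 ^ m"
proof -
  let ?G = "gaussian_matrix m (n + d)" and ?I = "{1..m} \<times> {1..n}" and ?S = "success_event m n A"
  interpret prob_space ?G by (rule prob_space_gaussian_matrix)
  define V where "V f = (\<lambda>\<omega>. \<lambda>p\<in>?I. \<omega> (f p)) -` ?S \<inter> space ?G" for f :: "nat \<times> nat \<Rightarrow> nat \<times> nat"
  have V: "V f \<in> events" "1 - p \<le> prob (V f)" if f: "inj_on f ?I" "f \<in> ?I \<rightarrow> {1..m} \<times> {1..n + d}" for f
  proof -
    note meas = reindex_measurable[OF f(2)]
    have S: "?S \<in> sets (gaussian_matrix m n)" "1 - p \<le> measure (gaussian_matrix m n) ?S"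
      using alg by (auto simp: online_algorithm_def)
    show "V f \<in> events" unfolding V_def using meas S(1) by (rule measurable_sets)
    have "measure (distr ?G (gaussian_matrix m n) (\<lambda>\<omega>. \<lambda>p\<in>?I. \<omega> (f p))) ?S = prob (V f)"
      unfolding V_def using meas S(1) by (rule measure_distr)
    then show "1 - p \<le> prob (V f)"
      using S(2) distr_gaussian_matrix_reindex[OF f] by simp
  qed
  have 1: "V (\<lambda>p. p) \<in> events" "1 - p \<le> prob (V (\<lambda>p. p))"
    by (intro V; auto)+
  have 2: "V (resample n d) \<in> events" "1 - p \<le> prob (V (resample n d))"
    by (intro V; auto simp: inj_on_def resample_def split: if_splits)+
  have "prob (V (\<lambda>p. p) \<union> V (resample n d))
      = prob (V (\<lambda>p. p)) + prob (V (resample n d)) - prob (V (\<lambda>p. p) \<inter> V (resample n d))"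
    using 1 2 by (intro measure_Un3) (auto simp: fmeasurable_eq_sets)
  then have "1 - 2 * p \<le> prob (V (\<lambda>p. p) \<inter> V (resample n d))"
    using 1 2 prob_le_1[of "V (\<lambda>p. p) \<union> V (resample n d)"] by linarith
  \<comment> \<open>The sign vector depends on the matrix and need not be a measurable function of
    it; the union over all fixed vectors is an event.\<close>
  also have "\<dots> \<le> prob (\<Union>\<tau>\<in>cube (n + d). both_rows_event m n d \<tau>)"
  proof (intro finite_measure_mono sets.finite_UN)
    show "finite (cube (n + d))" by (auto simp: cube_def intro!: finite_PiE)
    show "V (\<lambda>p. p) \<inter> V (resample n d) \<subseteq> (\<Union>\<tau>\<in>cube (n + d). both_rows_event m n d \<tau>)"
      using success_both_subset[OF alg d(2) _ refl _ refl] by (auto simp: V_def)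
  qed (use both_rows_event_sets[OF d(2)] in auto)
  also have "\<dots> \<le> (\<Sum>\<tau>\<in>cube (n + d). prob (both_rows_event m n d \<tau>))"
    using both_rows_event_sets[OF d(2)]
    by (intro finite_measure_subadditive_finite) (auto simp: cube_def intro!: finite_PiE)
  also have "\<dots> \<le> (\<Sum>\<tau>\<in>cube (n + d). 0.664 ^ m)"
  proof (intro sum_mono prob_both_rows[OF m d s])
    fix \<tau> j assume "\<tau> \<in> cube (n + d)" "j \<in> {1..n + d}"
    then have "\<tau> j \<in> {-1, 1}" unfolding cube_def by (rule PiE_mem)
    then show "\<bar>\<tau> j\<bar> = 1" by auto
  qed
  also have "\<dots> = 2 ^ (n + d) * 0.664 ^ m" by (simp add: card_cube)
  finally show ?thesis .
qed

text \<open>The logarithm of an inequality between rational powers that can be evaluated exactly.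
  The factors 1.04 and 1.77 are \<open>n + d\<close> and \<open>m\<close> relative to
  \<open>n\<close>.\<close>

lemma first_moment_rate: "1.04 * ln 2 + 1.77 * ln 0.664 < (0::real)"
proof -
  have "(2::real) ^ 104 * 0.664 ^ 177 < 1"
    by (simp add: power_divide)
  then have "ln ((2::real) ^ 104 * 0.664 ^ 177) < ln 1"
    by (subst ln_less_cancel_iff) auto
  also have "ln ((2::real) ^ 104 * 0.664 ^ 177) = 104 * ln 2 + 177 * ln 0.664"
    by (subst ln_mult) (simp_all only: ln_realpow zero_less_power, auto)
  finally show ?thesis by simp
qed

theorem theorem3p4:
  fixes \<alpha> :: real
  assumes "1.77 \<le> \<alpha>" and "\<alpha> \<le> alpha_c 1"
  shows "\<exists>c_f > 0. \<forall>\<^sub>F n in sequentially. \<forall>p_f :: real.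
           p_f < 1 / 2 - exp (- c_f * real n) \<longrightarrow>
           \<not> (\<exists>A. online_algorithm p_f (nat \<lfloor>real n * \<alpha>\<rfloor>) n A)"
proof -
  define c where "c = - (1.04 * ln 2 + 1.77 * ln (0.664 :: real))"
  have c: "0 < c" using first_moment_rate by (simp add: c_def)
  have of_nat_ge: "real_of_int z \<le> real (nat z)" for z by (cases "0 \<le> z") auto
  show ?thesis
  \<comment> \<open>The threshold 10000 is generous: rounding in \<open>n div 25\<close> must not
    push \<open>sqrt (d / n)\<close> below 0.199.\<close>
  proof (intro exI[of _ c] conjI c eventually_sequentiallyI[of 10000] allI impI notI)
    fix n p_f assume n: "10000 \<le> (n::nat)" and p: "p_f < 1 / 2 - exp (- c * real n)"
    assume "\<exists>A. online_algorithm p_f (nat \<lfloor>real n * \<alpha>\<rfloor>) n A"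
    then obtain A where alg: "online_algorithm p_f (nat \<lfloor>real n * \<alpha>\<rfloor>) n A" ..
    define m where "m = nat \<lfloor>real n * \<alpha>\<rfloor>"
    \<comment> \<open>The ratio \<open>d / n\<close> is then close to
      \<open>0.04 = 0.2\<^sup>2\<close> from below.\<close>
    define d where "d = n div 25"
    have d_bounds: "25 * d \<le> n" "n \<le> 25 * d + 24" by (auto simp: d_def)
    then have d: "1 \<le> d" "d < n" using n by auto
    have dn: "25 * real d \<le> real n" "real n \<le> 25 * real d + 24"
      using d_bounds by linarith+
    have "0.199 \<le> sqrt (real d / real n)"
      using dn n by (intro real_le_rsqrt) (simp add: field_simps power2_eq_square)
    moreover have "sqrt (real d / real n) \<le> 0.2"
      using dn n by (intro real_le_lsqrt) (simp_all add: field_simps power2_eq_square)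
    moreover have "real n * (177 / 100) \<le> real n * \<alpha>" using assms by (intro mult_left_mono) auto
    \<comment> \<open>The floor loses at most one row, which costs a factor \<open>1 / 0.664\<close>
      in the bound.\<close>
    then have m: "177 / 100 * real n - 1 \<le> real m"
      using real_of_int_floor_gt_diff_one[of "real n * \<alpha>"] of_nat_ge[of "\<lfloor>real n * \<alpha>\<rfloor>"] unfolding m_def by linarith
    moreover have "1 \<le> m" using m n by linarith
    ultimately have "1 - 2 * p_f \<le> 2 ^ (n + d) * 0.664 ^ m"
      using online_algorithm_first_moment[OF alg _ d refl] by (simp add: m_def)
    also have "\<dots> = exp (real (n + d) * ln 2 + real m * ln 0.664)"
      by (simp add: exp_add exp_of_nat_mult del: of_nat_add)
    also have "\<dots> \<le> exp (- c * real n - ln 0.664)"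
    proof -
      have "real (n + d) * ln 2 \<le> 1.04 * real n * ln 2"
        using dn by (intro mult_right_mono) auto
      moreover have "real m * ln (0.664::real) \<le> (177 / 100 * real n - 1) * ln 0.664"
        using m by (intro mult_right_mono_neg) auto
      ultimately have "real (n + d) * ln 2 + real m * ln 0.664
          \<le> 1.04 * real n * ln 2 + (177 / 100 * real n - 1) * ln 0.664" by (rule add_mono)
      also have "\<dots> = - c * real n - ln 0.664" by (simp add: c_def algebra_simps)
      finally show ?thesis by simp
    qed
    also have "\<dots> = exp (- c * real n) / 0.664"
      by (simp add: exp_diff)
    \<comment> \<open>The lost factor is below 2, while the assumption on \<open>p_f\<close> makes
      \<open>1 - 2 * p_f\<close> exceed \<open>2 * exp (- c * n)\<close>.\<close>
    also have "\<dots> \<le> 2 * exp (- c * real n)" by simp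
    finally show False using p by linarith
  qed
qed

end
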